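(* Let $X(z,w)=(f(z,w),g(z,w))\in\mathcal{VH}^1$ be a vector field on $\mathbb{H}^2$ which has divergence. Then the function $\mathrm{div}X(z,w)$ is bidegree full. If moreover $\mathrm{div}X(z,w)=0$, then $X$ is bidegree full.
   Context: $\mathbb{H}$ is the algebra of quaternions; $z,w$ are two non-commuting quaternionic variables. Power series. $\mathcal{H}^1[z,w]$ denotes the functions on $\mathbb{H}^2$ given by absolutely convergent series $\sum_d f_d(z,w)$, where each $f_d$ is a finite sum $\sum_{\alpha}(z,w)^{\alpha}a_{\alpha}$ with $a_\alpha\in\mathbb{H}$ and $\alpha\in\{0,1\}^d$; here for $\alpha=(\alpha_1,\dots,\alpha_d)$ the word $(z,w)^\alpha$ is the ordered product $(z^{\alpha_1}w^{1-\alpha_1})\cdots(z^{\alpha_d}w^{1-\alpha_d})$ (so all coefficients are on the right). Convention (formal uniqueness): two such functions are considered equal if and only if their power series coincide, i.e. the coefficients of all words coincide; in the same way, identities between expressions in $z,w,h$ that are linear in $h$ are identities between series of words in the non-commuting variables $z,w,h$ with right quaternionic coefficients. Partial derivatives. For $h\in\mathbb{H}$, $\widehat{\partial}_z f(z,w)[h]=\lim_{t\to0}\frac1t\,(f(z+th,w)-f(z,w))$ ($t$ real) and similarly $\widehat{\partial}_w$; i.e. $\widehat\partial_z$ replaces, in each monomial, one occurrence of $z$ at a time by $h$ and sums over all occurrences. Bidegree full. $S_{p,q}(z,w)=\sum_{\alpha\in\{0,1\}^{p+q},\,|\alpha|=p}(z,w)^\alpha$, where $|\alpha|=\sum_l\alpha_l$,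 is the sum of all words with $p$ letters $z$ and $q$ letters $w$. A function is bidegree full (BF) if it is a convergent series $\sum_{d\ge0}\sum_{p+q=d}S_{p,q}(z,w)a_{p,q}$ with $a_{p,q}\in\mathbb{H}$. Vector fields. $\mathcal{VH}^1$ is the set of vector fields $X=(f,g)$ on $\mathbb{H}^2$ with $f,g\in\mathcal{H}^1[z,w]$. $X$ is bidegree full if both $f$ and $g$ are. Put $\mathrm{Div}X(z,w)[h]=\widehat{\partial}_zf(z,w)[h]+\widehat{\partial}_wg(z,w)[h]$. $X$ has divergence if there is a function $\mathrm{div}X(z,w)$ with $\mathrm{Div}X(z,w)[h]=h\,\mathrm{div}X(z,w)$ for all $h$. *)

theory Defs
  imports "HOL-Analysis.Analysis"
begin

section \<open>Quaternions\<close>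

datatype quat = Quat (q0: real) (q1: real) (q2: real) (q3: real)

lemma quat_eq_iff: "x = y \<longleftrightarrow> q0 x = q0 y \<and> q1 x = q1 y \<and> q2 x = q2 y \<and> q3 x = q3 y"
  by (cases x; cases y) auto

instantiation quat :: ring_1
begin

definition "0 = Quat 0 0 0 0"
definition "1 = Quat 1 0 0 0"
definition "x + y = Quat (q0 x + q0 y) (q1 x + q1 y) (q2 x + q2 y) (q3 x + q3 y)"
definition "x - y = Quat (q0 x - q0 y) (q1 x - q1 y) (q2 x - q2 y) (q3 x - q3 y)"
definition "- x = Quat (- q0 x) (- q1 x) (- q2 x) (- q3 x)"
definition "x * y = Quat
  (q0 x * q0 y - q1 x * q1 y - q2 x * q2 y - q3 x * q3 y)
  (q0 x * q1 y + q1 x * q0 y + q2 x * q3 y - q3 x * q2 y)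
  (q0 x * q2 y - q1 x * q3 y + q2 x * q0 y + q3 x * q1 y)
  (q0 x * q3 y + q1 x * q2 y - q2 x * q1 y + q3 x * q0 y)"

instance
  by standard
    (simp_all add: quat_eq_iff zero_quat_def one_quat_def plus_quat_def minus_quat_def
      uminus_quat_def times_quat_def algebra_simps)

end

instantiation quat :: real_algebra_1
begin

definition "r *\<^sub>R x = Quat (r * q0 x) (r * q1 x) (r * q2 x) (r * q3 x)"

instance
  by standard
    (simp_all add: quat_eq_iff plus_quat_def times_quat_def scaleR_quat_def algebra_simps)

end

lemma quat_sel [simp]:
  "q0 0 = 0" "q1 0 = 0" "q2 0 = 0" "q3 0 = 0"
  "q0 1 = 1" "q1 1 = 0" "q2 1 = 0" "q3 1 = 0"
  "q0 (x + y) = q0 x + q0 y" "q1 (x + y) = q1 x + q1 y"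
  "q2 (x + y) = q2 x + q2 y" "q3 (x + y) = q3 x + q3 y"
  "q0 (x - y) = q0 x - q0 y" "q1 (x - y) = q1 x - q1 y"
  "q2 (x - y) = q2 x - q2 y" "q3 (x - y) = q3 x - q3 y"
  "q0 (- x) = - q0 x" "q1 (- x) = - q1 x" "q2 (- x) = - q2 x" "q3 (- x) = - q3 x"
  "q0 (r *\<^sub>R x) = r * q0 x" "q1 (r *\<^sub>R x) = r * q1 x"
  "q2 (r *\<^sub>R x) = r * q2 x" "q3 (r *\<^sub>R x) = r * q3 x"
  by (simp_all add: zero_quat_def one_quat_def plus_quat_def minus_quat_def uminus_quat_def
      scaleR_quat_def)

instantiation quat :: real_inner
begin

definition "inner x y = q0 x * q0 y + q1 x * q1 y + q2 x * q2 y + q3 x * q3 y"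
definition "norm (x::quat) = sqrt (inner x x)"
definition "dist (x::quat) y = norm (x - y)"
definition "sgn (x::quat) = x /\<^sub>R norm x"
definition "uniformity = (INF e\<in>{0 <..}. principal {(x, y :: quat). dist x y < e})"
definition "open (U :: quat set) \<longleftrightarrow>
  (\<forall>x\<in>U. eventually (\<lambda>(x', y). x' = x \<longrightarrow> y \<in> U) uniformity)"

instance
proof
  fix x y z :: quat and r :: real
  show "inner x y = inner y x" "inner (x + y) z = inner x z + inner y z"
    "inner (r *\<^sub>R x) y = r * inner x y" "0 \<le> inner x x"
    by (simp_all add: inner_quat_def algebra_simps)
  show "inner x x = 0 \<longleftrightarrow> x = 0"
    by (simp add: inner_quat_def quat_eq_iff add_nonneg_eq_0_iff)
  show "dist x y = norm (x - y)" by (simp add: dist_quat_def)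
  show "sgn x = x /\<^sub>R norm x" by (simp add: sgn_quat_def)
  show "norm x = sqrt (inner x x)" by (simp add: norm_quat_def)
qed (simp_all add: uniformity_quat_def open_quat_def)

end

lemma quat_norm_mult: "norm (x * y) = norm x * norm (y :: quat)"
proof -
  have "inner (x * y) (x * y) = inner x x * inner y y"
    by (simp add: inner_quat_def times_quat_def algebra_simps)
  then show ?thesis
    by (simp add: norm_quat_def real_sqrt_mult)
qed

instance quat :: real_normed_algebra_1
proof
  fix x y :: quat
  show "norm (x * y) \<le> norm x * norm y" by (simp add: quat_norm_mult)
  show "norm (1::quat) = 1" by (simp add: norm_quat_def inner_quat_def)
qed

instantiation quat :: real_normed_div_algebra
begin

definition "inverse x = Quat (q0 x) (- q1 x) (- q2 x) (- q3 x) /\<^sub>R inner x x"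
definition "x div (y::quat) = x * inverse y"

instance
proof
  fix x y :: quat
  show "norm (x * y) = norm x * norm y" by (rule quat_norm_mult)
  have *: "x * Quat (q0 x) (- q1 x) (- q2 x) (- q3 x) = inner x x *\<^sub>R 1"
    "Quat (q0 x) (- q1 x) (- q2 x) (- q3 x) * x = inner x x *\<^sub>R 1"
    by (simp_all add: quat_eq_iff times_quat_def inner_quat_def scaleR_quat_def algebra_simps)
  show "inverse x * x = 1" "x * inverse x = 1" if "x \<noteq> 0"
    using that by (simp_all add: inverse_quat_def *)
  show "x div y = x * inverse y" by (simp add: divide_quat_def)
  show "inverse (0::quat) = 0" by (simp add: inverse_quat_def)
qed

end

instantiation quat :: euclidean_space
begin

definition "Basis = {Quat 1 0 0 0, Quat 0 1 0 0, Quat 0 0 1 0, Quat 0 0 0 1}"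

instance
proof
  show "(Basis :: quat set) \<noteq> {}" "finite (Basis :: quat set)"
    by (simp_all add: Basis_quat_def)
  show "inner u v = (if u = v then 1 else 0)" if "u \<in> Basis" "v \<in> Basis" for u v :: quat
    using that unfolding Basis_quat_def
    by (elim insertE emptyE) (simp_all only: quat.inject inner_quat_def quat.sel, simp_all)
  show "(\<forall>u\<in>Basis. inner x u = 0) \<longleftrightarrow> x = 0" for x :: quat
    by (simp add: Basis_quat_def inner_quat_def) (simp add: quat_eq_iff)
qed

end

section \<open>Power series in two non-commuting variables\<close>

text \<open>
  A multi-index in \<open>{0,1}\<^sup>d\<close> is a boolean list of length \<open>d\<close>, with \<open>True\<close> for 1 (the letter \<open>z\<close>)
  and \<open>False\<close> for 0 (the letter \<open>w\<close>).
\<close>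

definition word :: "quat \<Rightarrow> quat \<Rightarrow> bool list \<Rightarrow> quat"
  where "word z w \<alpha> = prod_list (map (\<lambda>b. if b then z else w) \<alpha>)"

text \<open>
  Two functions given by power series are considered equal iff the coefficients of all words
  coincide, so such a function is represented by its family of (right) coefficients. Its value
  at \<open>(z,w)\<close> is \<open>\<Sum>\<^sub>d homog_part d f z w\<close>.
\<close>

type_synonym qseries = "bool list \<Rightarrow> quat"

definition homog_part :: "nat \<Rightarrow> qseries \<Rightarrow> quat \<Rightarrow> quat \<Rightarrow> quat"
  where "homog_part d f z w = (\<Sum>\<alpha> | length \<alpha> = d. word z w \<alpha> * f \<alpha>)"

definition H1 :: "qseries set"
  where "H1 = {f. \<forall>z w. summable (\<lambda>d. norm (homog_part d f z w))}"

section \<open>Bidegree full functions\<close>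

definition full_words :: "nat \<Rightarrow> nat \<Rightarrow> bool list set"
  where "full_words p q = {\<alpha>. length \<alpha> = p + q \<and> count_list \<alpha> True = p}"

definition S :: "nat \<Rightarrow> nat \<Rightarrow> quat \<Rightarrow> quat \<Rightarrow> quat"
  where "S p q z w = (\<Sum>\<alpha>\<in>full_words p q. word z w \<alpha>)"

text \<open>
  \<open>bf_series a\<close> is the coefficient family of \<open>\<Sum>\<^sub>d \<Sum>\<^sub>p\<^sub>+\<^sub>q\<^sub>=\<^sub>d S\<^sub>p\<^sub>,\<^sub>q a\<^sub>p\<^sub>,\<^sub>q\<close>: a word \<open>\<alpha>\<close> occurs in \<open>S\<^sub>p\<^sub>,\<^sub>q\<close> with
  coefficient 1 if \<open>\<alpha> \<in> full_words p q\<close>, and does not occur otherwise. Only the terms with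
  \<open>p + q = length \<alpha>\<close> can contribute.
\<close>

definition bf_series :: "(nat \<Rightarrow> nat \<Rightarrow> quat) \<Rightarrow> qseries"
  where "bf_series a \<alpha> =
    (\<Sum>(p, q) | p + q = length \<alpha>. if \<alpha> \<in> full_words p q then a p q else 0)"

definition bidegree_full :: "qseries \<Rightarrow> bool"
  where "bidegree_full f \<longleftrightarrow>
    (\<exists>a. f = bf_series a \<and>
         (\<forall>z w. summable (\<lambda>d. \<Sum>(p, q) | p + q = d. S p q z w * a p q)))"

section \<open>Partial derivatives\<close>

text \<open>
  Words in the three letters \<open>z\<close>, \<open>w\<close>, \<open>h\<close> are lists over \<open>bool option\<close>: \<open>Some True\<close> is \<open>z\<close>,
  \<open>Some False\<close> is \<open>w\<close>, and \<open>None\<close> is \<open>h\<close>.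
\<close>

type_synonym hseries = "bool option list \<Rightarrow> quat"

definition hword :: "quat \<Rightarrow> quat \<Rightarrow> quat \<Rightarrow> bool option list \<Rightarrow> quat"
  where "hword z w h \<beta> =
    prod_list (map (\<lambda>c. case c of None \<Rightarrow> h | Some b \<Rightarrow> if b then z else w) \<beta>)"

definition subst_h :: "bool list \<Rightarrow> nat \<Rightarrow> bool option list"
  where "subst_h \<alpha> i = (map Some \<alpha>)[i := None]"

text \<open>
  The partial derivative with respect to the variable \<open>v\<close> (\<open>True\<close> for \<open>z\<close>, \<open>False\<close> for \<open>w\<close>), as
  a series in the words in \<open>z\<close>, \<open>w\<close>, \<open>h\<close>. The coefficient of \<open>\<beta>\<close> collects the contributions of all
  words \<open>\<alpha>\<close> and all occurrences \<open>i\<close> of \<open>v\<close> in \<open>\<alpha>\<close> whose replacement by \<open>h\<close> yields \<open>\<beta>\<close>.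
  Lemmas \<open>word_deriv_z\<close> and \<open>word_deriv_w\<close> below show that this is the directional derivative.
\<close>

definition partial :: "bool \<Rightarrow> qseries \<Rightarrow> hseries"
  where "partial v f \<beta> =
    (\<Sum>(\<alpha>, i) | i < length \<alpha> \<and> \<alpha> ! i = v \<and> subst_h \<alpha> i = \<beta>. f \<alpha>)"

definition h_times :: "qseries \<Rightarrow> hseries"
  where "h_times D \<beta> = (\<Sum>\<alpha> | None # map Some \<alpha> = \<beta>. D \<alpha>)"

text \<open>The index sets of the preceding two sums are finite, so the sums are not vacuous.\<close>

lemma finite_partial_index:
  "finite {(\<alpha>, i). i < length \<alpha> \<and> \<alpha> ! i = v \<and> subst_h \<alpha> i = \<beta>}"
proof (rule finite_subset)
  show "{(\<alpha>, i). i < length \<alpha> \<and> \<alpha> ! i = v \<and> subst_h \<alpha> i = \<beta>}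
      \<subseteq> {\<alpha>. set \<alpha> \<subseteq> UNIV \<and> length \<alpha> = length \<beta>} \<times> {..<length \<beta>}"
    by (auto simp: subst_h_def)
  show "finite ({\<alpha> :: bool list. set \<alpha> \<subseteq> UNIV \<and> length \<alpha> = length \<beta>} \<times> {..<length \<beta>})"
    by (intro finite_cartesian_product finite_lists_length_eq) auto
qed

lemma h_times_Cons [simp]: "h_times D (None # map Some \<alpha>) = D \<alpha>"
proof -
  have "{\<gamma>. None # map Some \<gamma> = None # map Some \<alpha>} = {\<alpha>}"
    by (auto dest: map_injective)
  then show ?thesis by (simp add: h_times_def)
qed

lemma h_times_inj: "h_times D = h_times E \<Longrightarrow> D = E"
  by (metis ext h_times_Cons)

lemma hword_map_Some: "hword z w h (map Some \<alpha>) = word z w \<alpha>"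
  by (simp add: hword_def word_def comp_def)

lemma subst_h_Cons_0: "subst_h (b # \<alpha>) 0 = None # map Some \<alpha>"
  by (simp add: subst_h_def)

lemma subst_h_Cons_Suc: "subst_h (b # \<alpha>) (Suc i) = Some b # subst_h \<alpha> i"
  by (simp add: subst_h_def)

lemma sum_occurrences_Cons:
  "(\<Sum>i | i < length (b # \<alpha>) \<and> (b # \<alpha>) ! i = v. hword z w h (subst_h (b # \<alpha>) i)) =
   (if b = v then h * word z w \<alpha> else 0) +
   (if b then z else w) * (\<Sum>i | i < length \<alpha> \<and> \<alpha> ! i = v. hword z w h (subst_h \<alpha> i))"
proof -
  let ?I = "{i. i < length \<alpha> \<and> \<alpha> ! i = v}"
  have "{i. i < length (b # \<alpha>) \<and> (b # \<alpha>) ! i = v} = (if b = v then {0} else {}) \<union> Suc ` ?I"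
    by (auto simp: less_Suc_eq_0_disj image_iff)
  moreover have "(\<Sum>i\<in>Suc ` ?I. hword z w h (subst_h (b # \<alpha>) i)) =
      (if b then z else w) * (\<Sum>i\<in>?I. hword z w h (subst_h \<alpha> i))"
    by (simp add: sum.reindex subst_h_Cons_Suc hword_def sum_distrib_left)
  moreover have "hword z w h (subst_h (b # \<alpha>) 0) = h * word z w \<alpha>"
    unfolding subst_h_Cons_0 hword_map_Some [of z w h, symmetric] by (simp add: hword_def)
  ultimately show ?thesis
    by (auto simp: sum.union_disjoint)
qed

lemma word_deriv_aux:
  "((\<lambda>t. word (if v then z + t *\<^sub>R h else z) (if v then w else w + t *\<^sub>R h) \<alpha>)
     has_vector_derivative
    (\<Sum>i | i < length \<alpha> \<and> \<alpha> ! i = v. hword z w h (subst_h \<alpha> i))) (at 0)"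
proof (induction \<alpha>)
  case Nil
  then show ?case by (simp add: word_def)
next
  case (Cons b \<alpha>)
  let ?x = "\<lambda>t::real. if b = v then (if b then z else w) + t *\<^sub>R h else (if b then z else w)"
  have x: "(?x has_vector_derivative (if b = v then h else 0)) (at 0)"
    by (auto intro!: derivative_eq_intros)
  have eq: "(\<lambda>t. word (if v then z + t *\<^sub>R h else z) (if v then w else w + t *\<^sub>R h) (b # \<alpha>)) =
      (\<lambda>t. ?x t * word (if v then z + t *\<^sub>R h else z) (if v then w else w + t *\<^sub>R h) \<alpha>)"
    by (auto simp: word_def)
  show ?case
    unfolding sum_occurrences_Cons eq
    by (rule has_vector_derivative_eq_rhs [OF has_vector_derivative_mult [OF x Cons.IH]])
       (auto simp: add.commute)
qed

lemma has_vector_derivative_quotient_lim: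
  fixes F :: "real \<Rightarrow> 'a :: real_normed_vector"
  assumes "(F has_vector_derivative D) (at 0)"
  shows "((\<lambda>t. (F t - F 0) /\<^sub>R t) \<longlongrightarrow> D) (at 0)"
proof (rule LIM_zero_cancel, rule tendsto_norm_zero_cancel)
  have "((\<lambda>t. norm (F t - F 0 - t *\<^sub>R D) / norm (t - 0)) \<longlongrightarrow> 0) (at 0)"
    using assms by (simp add: has_vector_derivative_def has_derivative_iff_norm)
  moreover have "eventually (\<lambda>t. norm (F t - F 0 - t *\<^sub>R D) / norm (t - 0) =
      norm ((F t - F 0) /\<^sub>R t - D)) (at 0)"
    unfolding eventually_at_filter
  proof (intro always_eventually allI impI)
    fix t :: real
    assume "t \<noteq> 0"
    then have "(F t - F 0) /\<^sub>R t - D = (F t - F 0 - t *\<^sub>R D) /\<^sub>R t"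
      by (simp add: scaleR_diff_right)
    then show "norm (F t - F 0 - t *\<^sub>R D) / norm (t - 0) = norm ((F t - F 0) /\<^sub>R t - D)"
      by (simp add: divide_inverse mult.commute)
  qed
  ultimately show "((\<lambda>t. norm ((F t - F 0) /\<^sub>R t - D)) \<longlongrightarrow> 0) (at 0)"
    by (rule Lim_transform_eventually)
qed

lemma word_deriv_z:
  "((\<lambda>t. (word (z + t *\<^sub>R h) w \<alpha> - word z w \<alpha>) /\<^sub>R t) \<longlongrightarrow>
    (\<Sum>i | i < length \<alpha> \<and> \<alpha> ! i = True. hword z w h (subst_h \<alpha> i))) (at 0)"
  using has_vector_derivative_quotient_lim [OF word_deriv_aux [of True z h w \<alpha>]] by simp

lemma word_deriv_w:
  "((\<lambda>t. (word z (w + t *\<^sub>R h) \<alpha> - word z w \<alpha>) /\<^sub>R t) \<longlongrightarrow>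
    (\<Sum>i | i < length \<alpha> \<and> \<alpha> ! i = False. hword z w h (subst_h \<alpha> i))) (at 0)"
  using has_vector_derivative_quotient_lim [OF word_deriv_aux [of False z h w \<alpha>]] by simp

section \<open>Vector fields and divergence\<close>

type_synonym qfield = "qseries \<times> qseries"

definition VH1 :: "qfield set"
  where "VH1 = H1 \<times> H1"

definition bidegree_full_field :: "qfield \<Rightarrow> bool"
  where "bidegree_full_field X \<longleftrightarrow> bidegree_full (fst X) \<and> bidegree_full (snd X)"

definition Div :: "qfield \<Rightarrow> hseries"
  where "Div X \<beta> = partial True (fst X) \<beta> + partial False (snd X) \<beta>"

text \<open>
  \<open>Div X[h] = h div X\<close> is an identity of series of words in \<open>z\<close>, \<open>w\<close>, \<open>h\<close>, that is, of coefficient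
  families. As a function on \<open>H\<^sup>2\<close>, \<open>div X\<close> has to be a convergent series. Requiring absolute
  convergence is no restriction: if \<open>\<Sum>\<^sub>d D\<^sub>d(z,w)\<close> with \<open>D\<^sub>d\<close> homogeneous of degree \<open>d\<close> converges at
  \<open>(2z,2w)\<close>, then it converges absolutely at \<open>(z,w)\<close>.
\<close>

definition is_divergence :: "qfield \<Rightarrow> qseries \<Rightarrow> bool"
  where "is_divergence X D \<longleftrightarrow> D \<in> H1 \<and> Div X = h_times D"

definition has_divergence :: "qfield \<Rightarrow> bool"
  where "has_divergence X \<longleftrightarrow> (\<exists>D. is_divergence X D)"

definition divergence :: "qfield \<Rightarrow> qseries"
  where "divergence X = (THE D. is_divergence X D)"

lemma divergence_eqI: "is_divergence X D \<Longrightarrow> divergence X = D"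
  unfolding divergence_def
  by (rule the_equality) (auto simp: is_divergence_def intro: h_times_inj)

end

theory Submission
  imports Defs
begin

text \<open>
  Write \<open>X = (f, g)\<close>. The word \<open>u h v\<close> arises from exactly one monomial of \<open>f\<close>, namely \<open>u z v\<close>, and
  exactly one of \<open>g\<close>, namely \<open>u w v\<close>. Comparing coefficients in \<open>Div X[h] = h D\<close> therefore gives
  \<open>f(u z v) + g(u w v) = 0\<close> for every nonempty \<open>u\<close>, and \<open>f(z v) + g(w v) = D(v)\<close>
  (\<open>divergence_coefficients\<close>).

  By the first relation, two adjacent letters \<open>z w\<close> of a coefficient of \<open>f\<close> can be exchanged as soon
  as they are preceded by some letter: \<open>f(x z w y) = - g(x w w y) = f(x w z y)\<close>, and likewise
  \<open>g(x z w y) = - f(x z z y) = g(x w z y)\<close>. The second relation expresses \<open>D(v)\<close> by coefficients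
  in which \<open>v\<close> is preceded by a letter, so all adjacent letters of \<open>v\<close> can be exchanged in \<open>D(v)\<close>.
  If \<open>D = 0\<close>, the first relation holds for empty \<open>u\<close> as well, so adjacent letters can be exchanged
  everywhere in \<open>f\<close> and \<open>g\<close>.

  Finally, adjacent exchanges sort every word, so a series invariant under them has coefficients
  depending only on the bidegree, and each of its homogeneous parts is a combination of the
  \<open>S\<^sub>p\<^sub>,\<^sub>q\<close>. Convergence is then inherited from the series itself
  (\<open>bidegree_full_if_swap_invariant\<close>).
\<close>

definition swap_invariant :: "(bool list \<Rightarrow> 'a) \<Rightarrow> bool"
  where "swap_invariant f \<longleftrightarrow> (\<forall>x y. f (x @ True # False # y) = f (x @ False # True # y))"

lemma length_eq_count_True_False: "length \<alpha> = count_list \<alpha> True + count_list \<alpha> False"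
  by (induction \<alpha>) auto

lemma swap_invariant_move_False:
  assumes "swap_invariant f"
  shows "f (x @ False # replicate p True @ y) = f (x @ replicate p True @ False # y)"
proof (induction p arbitrary: x)
  case 0
  then show ?case by simp
next
  case (Suc p)
  have "f (x @ False # replicate (Suc p) True @ y) = f ((x @ [True]) @ False # replicate p True @ y)"
    using assms by (simp add: swap_invariant_def)
  also have "\<dots> = f ((x @ [True]) @ replicate p True @ False # y)"
    by (rule Suc)
  finally show ?case by simp
qed

text \<open>Insertion sort; the prefix \<open>x\<close> makes the induction hypothesis applicable below a first letter.\<close>

lemma swap_invariant_sort:
  assumes "swap_invariant f"
  shows "f (x @ \<alpha>) =
    f (x @ replicate (count_list \<alpha> True) True @ replicate (count_list \<alpha> False) False)"
proof (induction \<alpha> arbitrary: x)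
  case Nil
  then show ?case by simp
next
  case (Cons b \<alpha>)
  from Cons [of "x @ [b]"] show ?case
    by (cases b) (simp_all add: swap_invariant_move_False [OF assms])
qed

text \<open>
  The sums in \<open>bf_series\<close> and \<open>bidegree_full\<close> run over all bidegrees, but a word belongs to only one
  of them: the words of length \<open>d\<close> are the disjoint union of the \<open>full_words p q\<close> with \<open>p + q = d\<close>.
\<close>

lemma sum_over_bidegrees:
  fixes F :: "nat \<Rightarrow> nat \<Rightarrow> 'a::comm_monoid_add"
  assumes "length \<alpha> = d"
  shows "(\<Sum>(p, q) | p + q = d. if \<alpha> \<in> full_words p q then F p q else 0) =
    F (count_list \<alpha> True) (count_list \<alpha> False)"
proof -
  have "finite {(p, q). p + q = d}"
    by (rule finite_subset [of _ "{..d} \<times> {..d}"]) auto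
  then have "(\<Sum>(p, q) | p + q = d. if \<alpha> \<in> full_words p q then F p q else 0) =
      (\<Sum>(p, q)\<in>{(count_list \<alpha> True, count_list \<alpha> False)}. F p q)"
    using assms length_eq_count_True_False [of \<alpha>]
    by (intro sum.mono_neutral_cong_right) (auto simp: full_words_def split: if_splits)
  then show ?thesis by simp
qed

lemma finite_words: "finite {\<alpha> :: bool list. length \<alpha> = d}"
  using finite_lists_length_eq [of "UNIV :: bool set" d] by simp

lemma homog_part_bf_series:
  "homog_part d (bf_series a) z w = (\<Sum>(p, q) | p + q = d. S p q z w * a p q)"
proof -
  have "(\<Sum>(p, q) | p + q = d. S p q z w * a p q) =
      (\<Sum>(p, q) | p + q = d. \<Sum>\<alpha> | length \<alpha> = d.
         if \<alpha> \<in> full_words p q then word z w \<alpha> * a p q else 0)"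
  proof (rule sum.cong, goal_cases)
    case (2 pq)
    obtain p q where pq: "pq = (p, q)" by (cases pq)
    with 2 have "full_words p q = {\<alpha>. length \<alpha> = d} \<inter> full_words p q"
      by (auto simp: full_words_def)
    then have "S p q z w * a p q =
        (\<Sum>\<alpha>\<in>{\<alpha>. length \<alpha> = d} \<inter> full_words p q. word z w \<alpha> * a p q)"
      by (simp add: S_def sum_distrib_right)
    then show ?case
      unfolding pq sum.inter_restrict [OF finite_words] by simp
  qed simp
  also have "\<dots> = (\<Sum>\<alpha> | length \<alpha> = d. \<Sum>(p, q) | p + q = d.
         if \<alpha> \<in> full_words p q then word z w \<alpha> * a p q else 0)"
    unfolding case_prod_beta by (rule sum.swap)
  also have "\<dots> = homog_part d (bf_series a) z w"
    unfolding homog_part_def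
    by (rule sum.cong)
       (auto simp: bf_series_def sum_over_bidegrees
         sum_over_bidegrees [where F = "\<lambda>p q. word z w \<alpha> * a p q" for \<alpha>])
  finally show ?thesis ..
qed

theorem bidegree_full_if_swap_invariant:
  assumes "f \<in> H1" and "swap_invariant f"
  shows "bidegree_full f"
proof -
  define a where "a p q = f (replicate p True @ replicate q False)" for p q
  have f: "f = bf_series a"
    using swap_invariant_sort [OF assms(2), of "[]"]
    by (auto simp: fun_eq_iff bf_series_def sum_over_bidegrees a_def)
  have "summable (\<lambda>d. \<Sum>(p, q) | p + q = d. S p q z w * a p q)" for z w
    using assms(1) unfolding homog_part_bf_series [symmetric] f [symmetric]
    by (auto simp: H1_def intro: summable_norm_cancel)
  with f show ?thesis
    unfolding bidegree_full_def by blast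
qed

lemma partial_coefficient:
  "partial b f (map Some u @ None # map Some v) = f (u @ b # v)"
proof -
  have "\<alpha> = u @ b # v \<and> i = length u"
    if "i < length \<alpha>" "\<alpha> ! i = b" "subst_h \<alpha> i = map Some u @ None # map Some v" for \<alpha> i
    using that
  proof (induction \<alpha> arbitrary: i u)
    case (Cons c \<alpha>)
    show ?case
    proof (cases i)
      case 0
      with Cons.prems show ?thesis
        by (cases u) (auto simp: subst_h_Cons_0 dest: map_injective)
    next
      case (Suc j)
      with Cons.prems obtain u' where u': "u = c # u'"
        by (cases u) (auto simp: subst_h_Cons_Suc)
      with Suc Cons.prems Cons.IH [of j u'] show ?thesis
        by (simp add: subst_h_Cons_Suc)
    qed
  qed simp
  moreover have "subst_h (u @ b # v) (length u) = map Some u @ None # map Some v"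
    by (simp add: subst_h_def list_update_append)
  ultimately have "{(\<alpha>, i). i < length \<alpha> \<and> \<alpha> ! i = b \<and>
      subst_h \<alpha> i = map Some u @ None # map Some v} = {(u @ b # v, length u)}"
    by auto
  then show ?thesis
    by (simp add: partial_def)
qed

lemma h_times_nonempty_prefix:
  "u \<noteq> [] \<Longrightarrow> h_times D (map Some u @ None # map Some v) = 0"
  by (cases u) (simp_all add: h_times_def)

lemma divergence_coefficients:
  assumes "Div (f, g) = h_times D"
  shows "f (u @ True # v) + g (u @ False # v) = (if u = [] then D v else 0)"
proof -
  have "f (u @ True # v) + g (u @ False # v) = Div (f, g) (map Some u @ None # map Some v)"
    by (simp add: Div_def partial_coefficient)
  then show ?thesis
    by (simp add: assms h_times_nonempty_prefix)
qed

text \<open>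
  Exchanging \<open>z w\<close> behind the prefix \<open>x\<close> compares the coefficients of \<open>x h w y\<close> and \<open>x w h y\<close> (for
  \<open>f\<close>), or \<open>x z h y\<close> and \<open>x h z y\<close> (for \<open>g\<close>). The word with \<open>h\<close> in the later place never starts with
  \<open>h\<close>, and the other one does so only if \<open>x\<close> is empty; this is where a nonzero \<open>D\<close> obstructs the
  exchange.
\<close>

lemma exchange_coefficients:
  assumes "Div (f, g) = h_times D" and "x \<noteq> [] \<or> D = (\<lambda>\<alpha>. 0)"
  shows "f (x @ True # False # y) = f (x @ False # True # y)"
    and "g (x @ True # False # y) = g (x @ False # True # y)"
proof -
  note rel = divergence_coefficients [OF assms(1)]
  have "f (x @ True # False # y) + g (x @ False # False # y) = 0"
    using rel [of x "False # y"] assms(2) by auto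
  moreover have "f (x @ False # True # y) + g (x @ False # False # y) = 0"
    using rel [of "x @ [False]" y] by simp
  ultimately show "f (x @ True # False # y) = f (x @ False # True # y)"
    by (metis add_right_cancel)
  have "f (x @ True # True # y) + g (x @ True # False # y) = 0"
    using rel [of "x @ [True]" y] by simp
  moreover have "f (x @ True # True # y) + g (x @ False # True # y) = 0"
    using rel [of x "True # y"] assms(2) by auto
  ultimately show "g (x @ True # False # y) = g (x @ False # True # y)"
    by (metis add_left_cancel)
qed

lemma swap_invariant_divergence:
  assumes "Div (f, g) = h_times D"
  shows "swap_invariant D"
proof -
  have D: "D v = f (True # v) + g (False # v)" for v
    using divergence_coefficients [OF assms, of "[]" v] by simp
  show ?thesis
    unfolding swap_invariant_def D
    using exchange_coefficients(1) [OF assms, of "True # x" for x]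
      exchange_coefficients(2) [OF assms, of "False # x" for x]
    by simp
qed

theorem theorem3p4:
  fixes X :: qfield
  assumes "X \<in> VH1" and "has_divergence X"
  shows "bidegree_full (divergence X) \<and>
         (divergence X = (\<lambda>\<alpha>. 0) \<longrightarrow> bidegree_full_field X)"
proof -
  obtain f g where X: "X = (f, g)" by (cases X)
  with assms(1) have H1: "f \<in> H1" "g \<in> H1"
    by (auto simp: VH1_def)
  from assms(2) obtain D where D: "is_divergence X D"
    by (auto simp: has_divergence_def)
  then have Div: "Div (f, g) = h_times D" and "D \<in> H1"
    by (simp_all add: is_divergence_def X)
  then have "bidegree_full D"
    by (intro bidegree_full_if_swap_invariant swap_invariant_divergence)
  moreover have "bidegree_full_field X" if "D = (\<lambda>\<alpha>. 0)"
    using H1 exchange_coefficients [OF Div] that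
    by (auto simp: bidegree_full_field_def X swap_invariant_def
        intro!: bidegree_full_if_swap_invariant)
  ultimately show ?thesis
    by (simp add: divergence_eqI [OF D])
qed

end
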